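(* Let $0<v<+\infty$, $\alpha>0$, $c>0$, $\mu=\int_0^{+\infty}(1-F(z))\,dz<\infty$ and $\alpha\mu/c<1$. Let $L>0$ satisfy $$\frac{\alpha}{c}\int_0^{+\infty}e^{Lz}[1-F(z)]\,dz=1.$$ Let $\varphi^0$ be some bounded measurable initial function on $[0,v]$ and $$\varphi^{k+1}(u)=1-\frac{\alpha\mu}{c}+\frac{\alpha}{c}\int_0^u\varphi^k(u-z)[1-F(z)]\,dz,\qquad u\in[0,v],\ k=0,1,\dots$$ If for some $k\ge0$ one has $\varphi^k(u)\ge1-e^{-Lu}$ for all $u\in[0,v]$, then $\varphi^{k+1}(u)\ge1-e^{-Lu}$ for all $u\in[0,v]$.
   Context: $F$ is the distribution function of claim sizes, $F(z)=0$ for $z\le0$, with mean $\mu$. *)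

theory Defs
  imports "HOL-Probability.Probability"
begin

end

theory Submission imports Defs begin

text \<open>
  Put \<open>G = 1 - F \<ge> 0\<close>. For \<open>z \<le> u\<close> the hypothesis bounds \<open>\<phi>\<^sup>k(u - z) G(z)\<close> from below by
  \<open>G(z) - e\<^bsup>-Lu\<^esup> e\<^bsup>Lz\<^esup> G(z)\<close>, and for \<open>z > u\<close> the latter is nonpositive. Hence the convolution
  integral over \<open>[0, u]\<close> is at least the integral of that function over all of \<open>[0, \<infinity>)\<close>, which is
  \<open>\<mu> - e\<^bsup>-Lu\<^esup> c / \<alpha>\<close> by the Lundberg equation for \<open>L\<close>. For this to be legitimate the convolution
  integrand must be integrable, so boundedness and measurability are carried along the iteration;
  measurability comes from Fubini after replacing \<open>\<phi>\<^sup>k\<close> by an a.e. equal Borel function.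
\<close>

text \<open>The map sending \<open>x\<close> to \<open>u - x\<close> is affine with slope -1, so it
  preserves Lebesgue null sets. The exceptional set of \<open>P\<close> need not be Borel, hence the
  detour through a Borel null set \<open>N\<close> containing it.\<close>

lemma AE_lborel_reflect:
  fixes P :: "real \<Rightarrow> bool"
  assumes "AE x in lborel. P x"
  shows "AE x in lborel. P (u - x)"
proof -
  obtain N where N: "N \<in> null_sets lborel" "{x. \<not> P x} \<subseteq> N"
    using assms by (auto simp: eventually_ae_filter)
  have [measurable]: "N \<in> sets borel"
    using N(1) by auto
  have "AE x in lborel. u + (-1) * x \<notin> N"
    using AE_not_in[OF N(1)] by (intro AE_borel_affine) simp_all
  then show ?thesis
    by eventually_elim (use N(2) in auto)
qed

text \<open>In the completion every subset of a null set is measurable. A preimage under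
  \<open>f\<close> is the preimage under \<open>g\<close> off the null set where the two differ,
  plus some part of that null set.\<close>

lemma borel_measurable_completion_cong_AE:
  assumes g: "g \<in> borel_measurable M" and ae: "AE x in M. f x = g x"
  shows "f \<in> borel_measurable (completion M)"
proof (rule measurableI)
  fix A :: "'b set" assume [measurable]: "A \<in> sets borel"
  have [measurable]: "g \<in> borel_measurable (completion M)"
    using g by (rule measurable_completion)
  have [measurable]: "Measurable.pred (completion M) (\<lambda>x. f x \<noteq> g x)"
    by (rule sets_completion_AE) (use ae in simp)
  have [measurable]: "Measurable.pred (completion M) (\<lambda>x. f x \<noteq> g x \<and> f x \<in> A)"
    by (rule sets_completion_AE) (use ae in \<open>eventually_elim, simp\<close>)
  have "f -` A \<inter> space (completion M) =
      {x \<in> space (completion M). (g x \<in> A \<and> \<not> f x \<noteq> g x) \<or> (f x \<noteq> g x \<and> f x \<in> A)}"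
    by auto
  also have "\<dots> \<in> sets (completion M)"
    by measurable
  finally show "f -` A \<inter> space (completion M) \<in> sets (completion M)" .
qed simp

text \<open>Fubini needs a Borel function of the difference \<open>u - z\<close>, while
  \<open>f\<close> is only Lebesgue measurable. A single \<open>g\<close> serves all
  \<open>u\<close>; only the null set of exceptional \<open>z\<close> depends on
  \<open>u\<close>.\<close>

lemma convolution_AE_borel:
  fixes f G :: "real \<Rightarrow> real"
  assumes f: "f \<in> borel_measurable (lebesgue_on {0..v})"
    and G[measurable]: "G \<in> borel_measurable borel"
  obtains g where "g \<in> borel_measurable borel"
    and "\<And>u. u \<in> {0..v} \<Longrightarrow> AE z in lborel.
      indicator {0..u} z *\<^sub>R (f (u - z) * G z) = indicator {0..u} z *\<^sub>R (g (u - z) * G z)"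
proof -
  \<comment> \<open>Extending by zero makes \<open>f\<close> measurable on the whole line. The
    values off \<open>{0..v}\<close> never matter: \<open>u - z\<close> stays in
    \<open>{0..v}\<close> when \<open>z\<close> is in \<open>{0..u}\<close>, and the indicator
    vanishes otherwise.\<close>
  have "(\<lambda>x. if x \<in> {0..v} then f x else 0) \<in> borel_measurable lebesgue"
    using f by (subst borel_measurable_if) auto
  then obtain g where g: "g \<in> borel_measurable lborel"
      "AE x in lborel. (if x \<in> {0..v} then f x else 0) = g x"
    using completion_ex_borel_measurable_real by blast
  show thesis
  proof (rule that)
    show "g \<in> borel_measurable borel"
      using g(1) by simp
    fix u assume "u \<in> {0..v}"
    then show "AE z in lborel.
        indicator {0..u} z *\<^sub>R (f (u - z) * G z) = indicator {0..u} z *\<^sub>R (g (u - z) * G z)"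
      using AE_lborel_reflect[OF g(2), of u]
      by (elim eventually_mono) (auto simp: indicator_def split: if_splits)
  qed
qed

text \<open>The integrand is dominated by the constant \<open>B * C\<close> on a bounded interval,
  and it inherits measurability from its a.e. equal Borel version.\<close>

lemma convolution_set_integrable:
  fixes f G :: "real \<Rightarrow> real"
  assumes f: "f \<in> borel_measurable (lebesgue_on {0..v})" "\<And>x. x \<in> {0..v} \<Longrightarrow> \<bar>f x\<bar> \<le> B"
    and G: "G \<in> borel_measurable borel" "\<And>x. \<bar>G x\<bar> \<le> C"
    and u: "u \<in> {0..v}"
  shows "set_integrable lebesgue {0..u} (\<lambda>z. f (u - z) * G z)"
proof -
  note G(1)[measurable]
  obtain g where [measurable]: "g \<in> borel_measurable borel"
    and ae: "AE z in lborel.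
      indicator {0..u} z *\<^sub>R (f (u - z) * G z) = indicator {0..u} z *\<^sub>R (g (u - z) * G z)"
    using convolution_AE_borel[OF f(1) G(1)] u by metis
  have meas: "(\<lambda>z. indicator {0..u} z *\<^sub>R (f (u - z) * G z)) \<in> borel_measurable lebesgue"
    by (rule borel_measurable_completion_cong_AE[OF _ ae]) measurable
  have "\<bar>f (u - z) * G z\<bar> \<le> B * C" if "z \<in> {0..u}" for z
    unfolding abs_mult using u that f(2)[of "u - z"] G(2)[of z] by (intro mult_mono) auto
  \<comment> \<open>The norm on the right spares a proof that \<open>B * C\<close> is
    nonnegative.\<close>
  then have "norm (indicator {0..u} z *\<^sub>R (f (u - z) * G z)) \<le> norm (indicator {0..u} z * (B * C))" for z
    by (auto simp: indicator_def intro: order_trans[OF _ abs_ge_self])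
  moreover have "integrable lebesgue (\<lambda>z::real. indicator {0..u} z * (B * C))"
    using u by (intro integrable_mult_left) (simp add: integrable_indicator_iff)
  ultimately show ?thesis
    unfolding set_integrable_def
    by (intro Bochner_Integration.integrable_bound[OF _ meas] AE_I2)
qed

text \<open>For the Borel version \<open>g\<close> the integrand is jointly Borel in
  \<open>u\<close> and \<open>z\<close>, so its integral over \<open>z\<close> is Borel in
  \<open>u\<close>.\<close>

lemma convolution_measurable:
  fixes f G :: "real \<Rightarrow> real"
  assumes f: "f \<in> borel_measurable (lebesgue_on {0..v})"
    and G: "G \<in> borel_measurable borel"
  shows "(\<lambda>u. LINT z:{0..u}|lebesgue. f (u - z) * G z) \<in> borel_measurable (lebesgue_on {0..v})"
proof -
  note G[measurable]
  obtain g where [measurable]: "g \<in> borel_measurable borel"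
    and ae: "\<And>u. u \<in> {0..v} \<Longrightarrow> AE z in lborel.
      indicator {0..u} z *\<^sub>R (f (u - z) * G z) = indicator {0..u} z *\<^sub>R (g (u - z) * G z)"
    using convolution_AE_borel[OF f G] by metis
  define H where "H u = (\<integral>z. indicator {0..u} z *\<^sub>R (g (u - z) * G z) \<partial>lborel)" for u
  \<comment> \<open>The interval depends on \<open>u\<close>, so the indicator is spelled out as
    inequalities to make joint measurability visible.\<close>
  have "(\<lambda>u. \<integral>z. (if 0 \<le> z \<and> z \<le> u then g (u - z) * G z else 0) \<partial>lborel) \<in> borel_measurable borel"
    by measurable
  also have "(\<lambda>u. \<integral>z. (if 0 \<le> z \<and> z \<le> u then g (u - z) * G z else 0) \<partial>lborel) = H"
    unfolding H_def by (intro ext Bochner_Integration.integral_cong) (auto simp: indicator_def)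
  finally have "H \<in> borel_measurable (lebesgue_on {0..v})"
    by (intro measurable_restrict_space1 measurable_completion) simp
  \<comment> \<open>For each fixed \<open>u\<close> the integrands agree for almost all
    \<open>z\<close>, so the integrals agree for every \<open>u\<close> in the interval, not merely
    for almost every one.\<close>
  moreover have "H u = (LINT z:{0..u}|lebesgue. f (u - z) * G z)" if u: "u \<in> {0..v}" for u
  proof -
    have "H u = (\<integral>z. indicator {0..u} z *\<^sub>R (g (u - z) * G z) \<partial>lebesgue)"
      unfolding H_def by (rule integral_completion[symmetric]) measurable
    also have "\<dots> = (\<integral>z. indicator {0..u} z *\<^sub>R (f (u - z) * G z) \<partial>lebesgue)"
    proof (rule integral_cong_AE)
      show "(\<lambda>z. indicator {0..u} z *\<^sub>R (g (u - z) * G z)) \<in> borel_measurable lebesgue"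
        by (rule measurable_completion) measurable
      show "(\<lambda>z. indicator {0..u} z *\<^sub>R (f (u - z) * G z)) \<in> borel_measurable lebesgue"
        by (rule borel_measurable_completion_cong_AE[OF _ ae[OF u]]) measurable
      show "AE z in lebesgue.
          indicator {0..u} z *\<^sub>R (g (u - z) * G z) = indicator {0..u} z *\<^sub>R (f (u - z) * G z)"
        using AE_completion[OF ae[OF u]] by eventually_elim (rule sym)
    qed
    finally show ?thesis
      by (simp add: set_lebesgue_integral_def)
  qed
  ultimately show ?thesis
    by (subst measurable_cong[where g = H]) auto
qed

text \<open>The integrand is at most \<open>B * C\<close> on an interval of length
  \<open>u \<le> v\<close>. Uniformity in \<open>u\<close> is what keeps the next iterate
  bounded.\<close>

lemma convolution_bounded:
  fixes f G :: "real \<Rightarrow> real"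
  assumes f: "f \<in> borel_measurable (lebesgue_on {0..v})" "\<And>x. x \<in> {0..v} \<Longrightarrow> \<bar>f x\<bar> \<le> B"
    and G: "G \<in> borel_measurable borel" "\<And>x. \<bar>G x\<bar> \<le> C"
    and u: "u \<in> {0..v}"
  shows "\<bar>LINT z:{0..u}|lebesgue. f (u - z) * G z\<bar> \<le> B * C * v"
proof -
  have BC: "0 \<le> B" "0 \<le> C"
    using f(2)[OF u] G(2)[of 0] by linarith+
  have int: "integrable lebesgue (\<lambda>z. indicator {0..u} z *\<^sub>R (f (u - z) * G z))"
    using convolution_set_integrable[OF assms] by (simp add: set_integrable_def)
  have pt: "\<bar>f (u - z) * G z\<bar> \<le> B * C" if "z \<in> {0..u}" for z
    unfolding abs_mult using u that f(2)[of "u - z"] G(2)[of z] by (intro mult_mono) auto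
  have "\<bar>LINT z:{0..u}|lebesgue. f (u - z) * G z\<bar>
      \<le> (\<integral>z. norm (indicator {0..u} z *\<^sub>R (f (u - z) * G z)) \<partial>lebesgue)"
    unfolding set_lebesgue_integral_def real_norm_def[symmetric] by (rule integral_norm_bound)
  also have "\<dots> \<le> (\<integral>z. indicator {0..u} z * (B * C) \<partial>lebesgue)"
  proof (rule integral_mono)
    show "integrable lebesgue (\<lambda>z::real. indicator {0..u} z * (B * C))"
      using u by (intro integrable_mult_left) (simp add: integrable_indicator_iff)
    show "norm (indicator {0..u} z *\<^sub>R (f (u - z) * G z)) \<le> indicator {0..u} z * (B * C)" for z
      using pt[of z] by (auto simp: indicator_def)
  qed (rule integrable_norm[OF int])
  also have "\<dots> = u * (B * C)"
    using u by simp
  also have "\<dots> \<le> B * C * v"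
    using u mult_right_mono[of u v "B * C"] BC by (simp add: mult.commute)
  finally show ?thesis .
qed

text \<open>Regularity is assumed for \<open>\<phi> 0\<close> alone, but the comparison of integrals
  needs it for \<open>\<phi> k\<close>; the convolution preserves both properties.\<close>

lemma renewal_iterates_measurable_bounded:
  fixes \<phi> :: "nat \<Rightarrow> real \<Rightarrow> real" and G :: "real \<Rightarrow> real"
  assumes G: "G \<in> borel_measurable borel" "\<And>x. \<bar>G x\<bar> \<le> C"
    and init: "\<phi> 0 \<in> borel_measurable (lebesgue_on {0..v})" "bounded (\<phi> 0 ` {0..v})"
    and step: "\<And>j u. u \<in> {0..v} \<Longrightarrow>
           \<phi> (Suc j) u = a + b * (LINT z:{0..u}|lebesgue. \<phi> j (u - z) * G z)"
  shows "\<phi> j \<in> borel_measurable (lebesgue_on {0..v}) \<and> bounded (\<phi> j ` {0..v})"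
proof (induction j)
  case 0
  then show ?case using init by simp
next
  case (Suc j)
  let ?I = "\<lambda>u. LINT z:{0..u}|lebesgue. \<phi> j (u - z) * G z"
  from Suc.IH have "bounded (\<phi> j ` {0..v})" ..
  then obtain B where "\<forall>y\<in>\<phi> j ` {0..v}. norm y \<le> B"
    unfolding bounded_iff ..
  then have B: "\<bar>\<phi> j x\<bar> \<le> B" if "x \<in> {0..v}" for x
    using that by auto
  have [measurable]: "?I \<in> borel_measurable (lebesgue_on {0..v})"
    using Suc.IH G(1) by (intro convolution_measurable) auto
  have "(\<lambda>u. a + b * ?I u) \<in> borel_measurable (lebesgue_on {0..v})"
    by measurable
  then have "\<phi> (Suc j) \<in> borel_measurable (lebesgue_on {0..v})"
    by (subst measurable_cong[where g = "\<lambda>u. a + b * ?I u"]) (auto simp: step)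
  moreover have "\<bar>\<phi> (Suc j) u\<bar> \<le> \<bar>a\<bar> + \<bar>b\<bar> * (B * C * v)" if u: "u \<in> {0..v}" for u
  proof -
    have "\<bar>?I u\<bar> \<le> B * C * v"
      using Suc.IH B G u by (intro convolution_bounded) auto
    then have "\<bar>b * ?I u\<bar> \<le> \<bar>b\<bar> * (B * C * v)"
      unfolding abs_mult by (rule mult_left_mono) simp
    then show ?thesis
      unfolding step[OF u] by linarith
  qed
  then have "bounded (\<phi> (Suc j) ` {0..v})"
    unfolding bounded_iff by (auto intro!: exI[of _ "\<bar>a\<bar> + \<bar>b\<bar> * (B * C * v)"])
  ultimately show ?case by blast
qed

theorem lemma3p3:
  fixes M :: "real measure" and F :: "real \<Rightarrow> real"
    and v \<alpha> c \<mu> L :: real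
    and \<phi> :: "nat \<Rightarrow> real \<Rightarrow> real" and k :: nat
  assumes "real_distribution M" and "F = cdf M"
    and "\<And>z. z \<le> 0 \<Longrightarrow> F z = 0"
    and "v > 0" and "\<alpha> > 0" and "c > 0"
    and "set_integrable lebesgue {0..} (\<lambda>z. 1 - F z)"
    and "\<mu> = (LINT z:{0..}|lebesgue. 1 - F z)"
    and "\<alpha> * \<mu> / c < 1"
    and "L > 0"
    and "set_integrable lebesgue {0..} (\<lambda>z. exp (L * z) * (1 - F z))"
    and "\<alpha> / c * (LINT z:{0..}|lebesgue. exp (L * z) * (1 - F z)) = 1"
    and "\<phi> 0 \<in> borel_measurable (lebesgue_on {0..v})"
    and "bounded (\<phi> 0 ` {0..v})"
    and "\<And>j u. u \<in> {0..v} \<Longrightarrow>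
           \<phi> (Suc j) u = 1 - \<alpha> * \<mu> / c
             + \<alpha> / c * (LINT z:{0..u}|lebesgue. \<phi> j (u - z) * (1 - F z))"
    and "\<forall>u\<in>{0..v}. \<phi> k u \<ge> 1 - exp (- L * u)"
  shows "\<forall>u\<in>{0..v}. \<phi> (Suc k) u \<ge> 1 - exp (- L * u)"
proof
  fix u assume u: "u \<in> {0..v}"
  interpret real_distribution M by fact
  define G where "G z = 1 - F z" for z
  \<comment> \<open>A distribution function lies between 0 and 1, so the bound \<open>C\<close> of
    the convolution lemmas can be taken to be 1.\<close>
  have G01: "0 \<le> G z" "\<bar>G z\<bar> \<le> 1" for z
    using cdf_nonneg[of z] cdf_bounded_prob[of z] by (auto simp: G_def assms(2))
  have "mono F"
    unfolding assms(2) by (intro monoI cdf_nondecreasing)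
  then have [measurable]: "F \<in> borel_measurable borel"
    by (rule borel_measurable_mono)
  have G_meas: "G \<in> borel_measurable borel"
    unfolding G_def[abs_def] by measurable
  have step: "\<phi> (Suc j) u = (1 - \<alpha> * \<mu> / c) + \<alpha> / c * (LINT z:{0..u}|lebesgue. \<phi> j (u - z) * G z)"
    if "u \<in> {0..v}" for j u
    using assms(15)[OF that] by (simp add: G_def)
  have phi: "\<phi> k \<in> borel_measurable (lebesgue_on {0..v})" "bounded (\<phi> k ` {0..v})"
    using renewal_iterates_measurable_bounded[OF G_meas G01(2) assms(13,14) step] by auto
  from phi(2) obtain B where "\<forall>y\<in>\<phi> k ` {0..v}. norm y \<le> B"
    unfolding bounded_iff ..
  then have B: "\<bar>\<phi> k x\<bar> \<le> B" if "x \<in> {0..v}" for x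
    using that by auto
  have intG: "set_integrable lebesgue {0..} G"
    and intE: "set_integrable lebesgue {0..} (\<lambda>z. exp (- L * u) * (exp (L * z) * G z))"
    using assms(7) set_integrable_mult_right[OF assms(11)] unfolding G_def by simp_all
  have E: "(LINT z:{0..}|lebesgue. exp (L * z) * G z) = c / \<alpha>"
    using assms(5,6,12) by (simp add: G_def field_simps)
  have "\<mu> - exp (- L * u) * (c / \<alpha>)
      = (LINT z:{0..}|lebesgue. G z - exp (- L * u) * (exp (L * z) * G z))"
    using set_integral_diff(2)[OF intG intE] E assms(8) by (simp add: G_def)
  \<comment> \<open>The two domains differ, so the integrands are compared on the whole line with
    their indicators included.\<close>
  also have "\<dots> \<le> (LINT z:{0..u}|lebesgue. \<phi> k (u - z) * G z)"
    unfolding set_lebesgue_integral_def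
  proof (rule integral_mono)
    show "integrable lebesgue (\<lambda>z. indicator {0..} z *\<^sub>R (G z - exp (- L * u) * (exp (L * z) * G z)))"
      using set_integral_diff(1)[OF intG intE] by (simp add: set_integrable_def)
    show "integrable lebesgue (\<lambda>z. indicator {0..u} z *\<^sub>R (\<phi> k (u - z) * G z))"
      using convolution_set_integrable[OF phi(1) B G_meas G01(2) u] by (simp add: set_integrable_def)
    fix z :: real
    \<comment> \<open>This exposes the assumed lower bound for \<open>\<phi> k\<close> at the point
      \<open>u - z\<close>, multiplied by \<open>G z\<close>.\<close>
    have eq: "G z - exp (- L * u) * (exp (L * z) * G z) = (1 - exp (- L * (u - z))) * G z"
      by (simp add: algebra_simps flip: exp_add)
    consider "z < 0" | "z \<in> {0..u}" | "0 \<le> z" "u < z"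
      by force
    then show "indicator {0..} z *\<^sub>R (G z - exp (- L * u) * (exp (L * z) * G z))
        \<le> indicator {0..u} z *\<^sub>R (\<phi> k (u - z) * G z)"
    proof cases
      case 2
      then have "1 - exp (- L * (u - z)) \<le> \<phi> k (u - z)"
        using assms(16) u by auto
      then have "(1 - exp (- L * (u - z))) * G z \<le> \<phi> k (u - z) * G z"
        using G01(1) by (rule mult_right_mono)
      then show ?thesis
        using 2 unfolding eq by simp
    next
      case 3
      \<comment> \<open>Beyond \<open>u\<close> the right-hand integrand is zero, while
        \<open>L > 0\<close> and \<open>u - z < 0\<close> make the left-hand factor
        nonpositive.\<close>
      then have "0 \<le> - L * (u - z)"
        using assms(10) by (simp add: mult_nonneg_nonpos)
      then have "(1 - exp (- L * (u - z))) * G z \<le> 0"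
        using G01(1)[of z] by (intro mult_nonpos_nonneg) simp_all
      then show ?thesis
        using 3 unfolding eq by simp
    qed simp
  qed
  \<comment> \<open>After scaling, the term \<open>\<alpha> * \<mu> / c\<close> cancels against the
    constant of the recursion and exactly \<open>1 - exp (- L * u)\<close> remains.\<close>
  finally have "\<alpha> / c * (\<mu> - exp (- L * u) * (c / \<alpha>))
      \<le> \<alpha> / c * (LINT z:{0..u}|lebesgue. \<phi> k (u - z) * G z)"
    using assms(5,6) by (intro mult_left_mono) auto
  moreover have "\<alpha> / c * (\<mu> - exp (- L * u) * (c / \<alpha>)) = \<alpha> * \<mu> / c - exp (- L * u)"
    using assms(5,6) by (simp add: field_simps)
  ultimately show "1 - exp (- L * u) \<le> \<phi> (Suc k) u"
    unfolding step[OF u] by linarith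
qed

end
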